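(* Let $m=m(n)$ be positive integers and $p=p(n)\in[0,1]$, and let $H=H(n)\sim\mathbb{H}(n,m,p)$. Suppose that, as $n\to\infty$, $pn\to\infty$, $pm\to\infty$, and $p$ is bounded away from $1$ (i.e. $p\le 1-\varepsilon_0$ for some constant $\varepsilon_0>0$). (i) If $m=O(n)$, then with high probability $$\operatorname{disc}(H)=\Omega\left(\max\left\{2^{-n/m}\sqrt{pn},\,1\right\}\right).$$ (ii) If $m\gg n$, then with high probability $$\operatorname{disc}(H)=\Omega\left(\sqrt{pn\log\gamma}\right),\qquad\text{where }\gamma:=\min\{m/n,\,pn\}.$$ Here "with high probability $\operatorname{disc}(H)=\Omega(g(n))$" means that there is a constant $\kappa>0$ (not depending on $n$) such that $\mathbb{P}[\operatorname{disc}(H)\ge\kappa\, g(n)]\to1$ as $n\to\infty$.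
   Context: A hypergraph $H=(V,E)$ consists of a vertex set $V=\{v_1,\dots,v_n\}$ and a multiset $E=\{e_1,\dots,e_m\}$ of subsets of $V$ (edges; repetitions allowed). A colouring is a function $\psi:V\to\{-1,1\}$; for an edge $e$ put $\psi(e)=\sum_{v\in e}\psi(v)$, and $\operatorname{disc}(\psi)=\max_{e\in E}|\psi(e)|$. The discrepancy of $H$ is $\operatorname{disc}(H)=\min_\psi\operatorname{disc}(\psi)$, the minimum being over all colourings. Edge-independent model $\mathbb{H}(n,m,p)$: the random hypergraph with vertices $v_1,\dots,v_n$ and edges $e_1,\dots,e_m$ in which each vertex $v_j$ is placed in each edge $e_i$ independently with probability $p$ (all $mn$ choices independent). All asymptotics are as $n\to\infty$; $m\gg n$ means $n/m\to0$; $\log$ is the natural logarithm. An event holds with high probability if its probability tends to $1$ as $n\to\infty$. *)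

theory Defs
  imports "HOL-Probability.Probability" "HOL-Library.Landau_Symbols" "HOL-Library.Multiset"
begin

text \<open>A hypergraph is a vertex set together with a multiset of edges.\<close>

type_synonym 'a hypergraph = "'a set \<times> 'a set multiset"

definition hypergraph :: "'a hypergraph \<Rightarrow> bool" where
  "hypergraph H \<longleftrightarrow> finite (fst H) \<and> (\<forall>e\<in>#snd H. e \<subseteq> fst H)"

definition colourings :: "'a set \<Rightarrow> ('a \<Rightarrow> int) set" where
  "colourings V = V \<rightarrow>\<^sub>E {-1, 1}"

text \<open>The maximum is over the edges, so it is only meaningful when there is at least one edge.\<close>

definition disc_colouring :: "'a hypergraph \<Rightarrow> ('a \<Rightarrow> int) \<Rightarrow> int" where
  "disc_colouring H \<psi> = Max ((\<lambda>e. \<bar>\<Sum>v\<in>e. \<psi> v\<bar>) ` set_mset (snd H))"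

definition disc :: "'a hypergraph \<Rightarrow> int" where
  "disc H = Min (disc_colouring H ` colourings (fst H))"

text \<open>The hypergraph on vertices \<open>1, \<dots>, n\<close> whose edges are the rows \<open>1, \<dots>, m\<close> of an
  incidence matrix: \<open>X (i, j)\<close> says that vertex \<open>j\<close> lies in edge \<open>i\<close>.\<close>

definition incidence_hypergraph :: "nat \<Rightarrow> nat \<Rightarrow> (nat \<times> nat \<Rightarrow> bool) \<Rightarrow> nat hypergraph" where
  "incidence_hypergraph n m X = ({1..n}, {#{j \<in> {1..n}. X (i, j)}. i \<in># mset_set {1..m}#})"

text \<open>The edge-independent model: the \<open>mn\<close> incidences are independent with probability \<open>p\<close>.
  (The value \<open>False\<close> is only the default of \<open>X\<close> outside the index set.)\<close>

definition edge_independent :: "nat \<Rightarrow> nat \<Rightarrow> real \<Rightarrow> nat hypergraph pmf" where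
  "edge_independent n m p =
     map_pmf (incidence_hypergraph n m)
       (Pi_pmf ({1..m} \<times> {1..n}) False (\<lambda>_. bernoulli_pmf p))"

lemma edge_independent_hypergraph:
  assumes "H \<in> set_pmf (edge_independent n m p)"
  shows "hypergraph H" "fst H = {1..n}" "size (snd H) = m"
  using assms by (auto simp: edge_independent_def incidence_hypergraph_def hypergraph_def)

end

theory Submission
  imports Defs
begin

text \<open>
  Both bounds come from the first moment method. The edges of the random hypergraph are \<open>m\<close>
  independent copies of a random set \<open>e \<subseteq> {1..n}\<close>, so if every colouring \<open>\<psi>\<close> satisfies
  \<open>P(\<bar>\<psi>(e)\<bar> < t) \<le> r\<close>, then a union bound over the \<open>2 ^ n\<close> colourings gives
  \<open>P(disc(H) < t) \<le> 2 ^ n * r ^ m\<close> (\<open>prob_disc_less_le\<close>). Everything rests on two estimates for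
  the signed sum \<open>\<psi>(e)\<close>, uniform in \<open>\<psi>\<close>; both start from the product formula
  \<open>E(\<Prod>v\<in>e. g v) = (\<Prod>v\<in>V. p * g v + (1 - p))\<close>. Write \<open>a = p (1 - p) n\<close>, the variance of \<open>\<psi>(e)\<close>.

  Part (i) needs an anti-concentration bound. The characteristic function of \<open>\<psi>(e)\<close> has modulus at
  most \<open>exp (- a (1 - cos t))\<close>, whatever the signs are, and Fourier inversion yields
  \<open>P(\<psi>(e) = k) \<le> 2 / sqrt a\<close>, hence \<open>P(\<bar>\<psi>(e)\<bar> < t) \<le> 6 t / sqrt a\<close> for \<open>t \<ge> 1\<close>
  (\<open>prob_sum_small_le\<close>). For \<open>t\<close> a small multiple of \<open>2 powr (- n/m) * sqrt (p n)\<close> this is at most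
  \<open>2 powr (- n/m) / 2\<close>, whose \<open>m\<close>-th power beats the \<open>2 ^ n\<close> colourings. If this \<open>t\<close> is below \<open>1\<close>,
  only \<open>disc(H) \<ge> 1\<close> is claimed, and this holds as soon as one edge has odd size, because then no
  colouring can balance that edge. The same characteristic function, evaluated at \<open>\<pi>\<close>, shows that
  an edge is even with probability at most \<open>3/4\<close> once \<open>a\<close> is large (\<open>prob_even_card_le\<close>), and
  \<open>m \<rightarrow> \<infinity>\<close> because \<open>p m \<rightarrow> \<infinity>\<close>.

  Part (ii) needs a lower bound for the tail, which is the Paley-Zygmund inequality applied to
  \<open>W = exp (x (\<psi>(e) - E \<psi>(e)))\<close> (\<open>prob_sum_large_ge\<close>). With \<open>L = x\<^sup>2 a\<close>, the first moment of \<open>W\<close>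
  is at least \<open>exp (L/8)\<close> and the second at most \<open>exp (4 L)\<close>, so with probability at least
  \<open>exp (- 4 L) / 4\<close> the exponent is at least \<open>L/8 - ln 2\<close>. Choosing \<open>L = (ln \<gamma>)/8\<close> makes
  \<open>\<bar>\<psi>(e)\<bar>\<close> at least of order \<open>sqrt (a ln \<gamma>)\<close> with probability at least \<open>1 / (4 sqrt \<gamma>)\<close>. The condition
  \<open>\<gamma> \<le> p n\<close> keeps \<open>x\<close> small, and \<open>\<gamma> \<le> m / n\<close> makes \<open>m / sqrt \<gamma>\<close> at least
  \<open>n sqrt (m / n)\<close>, so that \<open>(1 - 1 / (4 sqrt \<gamma>)) ^ m\<close> again beats \<open>2 ^ n\<close>.
\<close>

section \<open>Random subsets\<close>

definition random_subset :: "'a set \<Rightarrow> real \<Rightarrow> 'a set pmf" where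
  "random_subset V p = map_pmf (\<lambda>x. {v \<in> V. x v}) (Pi_pmf V False (\<lambda>_. bernoulli_pmf p))"

lemma set_pmf_random_subset: "set_pmf (random_subset V p) \<subseteq> Pow V"
  by (auto simp: random_subset_def)

lemma finite_set_pmf_random_subset [simp]:
  assumes "finite V"
  shows "finite (set_pmf (random_subset V p))"
  using finite_subset[OF set_pmf_random_subset[of V p]] assms by simp

lemma integrable_random_subset:
  fixes f :: "'a set \<Rightarrow> 'b :: {banach, second_countable_topology}"
  assumes "finite V"
  shows "integrable (measure_pmf (random_subset V p)) f"
  using assms by (intro integrable_measure_pmf_finite) simp

lemma pmf_random_subset:
  assumes "finite V" "e \<subseteq> V" "0 \<le> p" "p \<le> 1"
  shows "pmf (random_subset V p) e = (\<Prod>v\<in>e. p) * (\<Prod>v\<in>V - e. 1 - p)"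
proof -
  have vim: "(\<lambda>x. {v \<in> V. x v}) -` {e} = Pi V (\<lambda>v. {v \<in> e})"
    using assms(2) by (auto simp: Pi_def)
  have "pmf (random_subset V p) e
      = (\<Prod>v\<in>V. measure_pmf.prob (bernoulli_pmf p) {v \<in> e})"
    using assms(1) by (simp add: random_subset_def pmf_map vim measure_Pi_pmf_Pi)
  also have "\<dots> = (\<Prod>v\<in>V. if v \<in> e then p else 1 - p)"
    using assms by (intro prod.cong) (auto simp: measure_pmf_single)
  also have "\<dots> = (\<Prod>v\<in>e. p) * (\<Prod>v\<in>V - e. 1 - p)"
    using assms by (simp add: prod.If_cases Int_absorb1 Diff_eq)
  finally show ?thesis .
qed

text \<open>
  Multiplicative functionals factor over the vertices. This single formula gives the characteristic
  function of a signed sum (complex \<open>g\<close>) as well as its exponential moments (real \<open>g\<close>).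
\<close>

lemma expectation_prod_random_subset:
  fixes g :: "'a \<Rightarrow> 'b :: {real_normed_field, banach, second_countable_topology}"
  assumes "finite V" "0 \<le> p" "p \<le> 1"
  shows "measure_pmf.expectation (random_subset V p) (\<lambda>e. \<Prod>v\<in>e. g v)
       = (\<Prod>v\<in>V. of_real p * g v + of_real (1 - p))"
proof -
  have "measure_pmf.expectation (random_subset V p) (\<lambda>e. \<Prod>v\<in>e. g v)
      = (\<Sum>e\<in>Pow V. pmf (random_subset V p) e *\<^sub>R (\<Prod>v\<in>e. g v))"
    using set_pmf_random_subset[of V p] assms(1)
    by (intro integral_measure_pmf) auto
  also have "\<dots> = (\<Sum>e\<in>Pow V. (\<Prod>v\<in>e. of_real p * g v) * (\<Prod>v\<in>V - e. of_real (1 - p)))"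
    using assms by (intro sum.cong refl)
      (simp add: pmf_random_subset scaleR_conv_of_real prod.distrib mult_ac)
  also have "\<dots> = (\<Prod>v\<in>V. of_real p * g v + of_real (1 - p))"
    using prod_add[OF assms(1), of "\<lambda>v. of_real p * g v" "\<lambda>_. of_real (1 - p)"] by simp
  finally show ?thesis .
qed

section \<open>Independence of the edges and the union bound over colourings\<close>

text \<open>
  Intersecting with the supports reduces the claim to countable sets.
\<close>

lemma prob_pair_pmf_Times:
  "measure_pmf.prob (pair_pmf M N) (A \<times> B) = measure_pmf.prob M A * measure_pmf.prob N B"
proof -
  have "measure_pmf.prob (pair_pmf M N) (A \<times> B)
      = measure_pmf.prob (pair_pmf M N) ((A \<times> B) \<inter> set_pmf (pair_pmf M N))"
    by (simp only: measure_Int_set_pmf)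
  also have "(A \<times> B) \<inter> set_pmf (pair_pmf M N) = (A \<inter> set_pmf M) \<times> (B \<inter> set_pmf N)"
    by auto
  also have "measure_pmf.prob (pair_pmf M N) \<dots>
      = measure_pmf.prob M (A \<inter> set_pmf M) * measure_pmf.prob N (B \<inter> set_pmf N)"
    by (intro measure_pmf_prob_product countable_Int2 countable_set_pmf)
  finally show ?thesis by (simp only: measure_Int_set_pmf)
qed

text \<open>
  The rows of the incidence matrix are independent copies of a random subset: the index set
  \<open>insert i I \<times> V\<close> splits into the row of \<open>i\<close> and the remaining rows.
\<close>

lemma prob_all_rows:
  fixes V :: "'a set" and I :: "'b set"
  assumes "finite V" "finite I"
  shows "measure_pmf.prob (Pi_pmf (I \<times> V) False (\<lambda>_. bernoulli_pmf p))
           {X. \<forall>i\<in>I. {v \<in> V. X (i, v)} \<in> A}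
       = measure_pmf.prob (random_subset V p) A ^ card I"
  using assms(2)
proof (induction I rule: finite_induct)
  case empty
  then show ?case by simp
next
  case (insert i I)
  let ?B = "\<lambda>_. bernoulli_pmf p"
  have row: "measure_pmf.prob (Pi_pmf ({i} \<times> V) False ?B) {X. {v \<in> V. X (i, v)} \<in> A}
      = measure_pmf.prob (random_subset V p) A"
  proof -
    (* A row is V reindexed along v |-> (i, v). *)
    have "Pi_pmf V False ?B = map_pmf (\<lambda>X. X \<circ> Pair i) (Pi_pmf ({i} \<times> V) False ?B)"
      using assms(1) by (intro Pi_pmf_bij_betw) (auto simp: bij_betw_def inj_on_def)
    then have "random_subset V p
        = map_pmf (\<lambda>X. {v \<in> V. X (i, v)}) (Pi_pmf ({i} \<times> V) False ?B)"
      unfolding random_subset_def by (simp only: pmf.map_comp comp_def)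
    then show ?thesis
      by (simp only: measure_map_pmf vimage_def)
  qed
  have split: "insert i I \<times> V = ({i} \<times> V) \<union> (I \<times> V)" by auto
  have "Pi_pmf (insert i I \<times> V) False ?B
      = map_pmf (\<lambda>(f, g) x. if x \<in> {i} \<times> V then f x else g x)
          (pair_pmf (Pi_pmf ({i} \<times> V) False ?B) (Pi_pmf (I \<times> V) False ?B))"
    unfolding split using assms(1) insert.hyps by (intro Pi_pmf_union) auto
  moreover have "(\<lambda>(f, g) x. if x \<in> {i} \<times> V then f x else g x)
        -` {X. \<forall>k\<in>insert i I. {v \<in> V. X (k, v)} \<in> A}
      = {X. {v \<in> V. X (i, v)} \<in> A} \<times> {X. \<forall>k\<in>I. {v \<in> V. X (k, v)} \<in> A}"
  proof -
    have "(case P of (f, g) \<Rightarrow> \<lambda>x. if x \<in> {i} \<times> V then f x else g x)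
          \<in> {X. \<forall>k\<in>insert i I. {v \<in> V. X (k, v)} \<in> A}
        \<longleftrightarrow> P \<in> {X. {v \<in> V. X (i, v)} \<in> A} \<times> {X. \<forall>k\<in>I. {v \<in> V. X (k, v)} \<in> A}" for P
    proof -
      obtain f g where P: "P = (f, g)" by (cases P)
      define h where "h = (\<lambda>x. if x \<in> {i} \<times> V then f x else g x)"
      have i: "{v \<in> V. h (i, v)} = {v \<in> V. f (i, v)}" by (auto simp: h_def)
      have k: "{v \<in> V. h (k, v)} = {v \<in> V. g (k, v)}" if "k \<in> I" for k
        using that insert.hyps by (auto simp: h_def)
      have "(\<forall>k\<in>insert i I. {v \<in> V. h (k, v)} \<in> A)
          \<longleftrightarrow> {v \<in> V. f (i, v)} \<in> A \<and> (\<forall>k\<in>I. {v \<in> V. g (k, v)} \<in> A)"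
        by (simp add: i k cong: ball_cong)
      then show ?thesis
        unfolding P prod.case h_def[symmetric] by simp
    qed
    then show ?thesis by blast
  qed
  ultimately show ?case
    using insert.hyps by (simp only: measure_map_pmf prob_pair_pmf_Times row insert.IH) simp
qed

lemma prob_all_edges:
  "measure_pmf.prob (edge_independent n m p) {H. \<forall>e\<in>#snd H. e \<in> A}
     = measure_pmf.prob (random_subset {1..n} p) A ^ m"
  using prob_all_rows[of "{1..n}" "{1..m}" p A]
  by (simp add: edge_independent_def incidence_hypergraph_def vimage_def)

lemma finite_colourings: "finite V \<Longrightarrow> finite (colourings V)"
  by (simp add: colourings_def finite_PiE)

lemma card_colourings: "finite V \<Longrightarrow> card (colourings V) = 2 ^ card V"
  by (simp add: colourings_def card_PiE numeral_2_eq_2)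

lemma colourings_nonempty: "colourings V \<noteq> {}"
  by (simp add: colourings_def PiE_eq_empty_iff)

lemma ex_colouring_if_disc_less:
  assumes "finite (fst H)" "real_of_int (disc H) < t"
  shows "\<exists>\<psi>\<in>colourings (fst H). \<forall>e\<in>#snd H. real_of_int \<bar>\<Sum>v\<in>e. \<psi> v\<bar> < t"
proof -
  have "disc H \<in> disc_colouring H ` colourings (fst H)"
    unfolding disc_def using assms(1) finite_colourings colourings_nonempty
    by (intro Min_in) auto
  then obtain \<psi> where \<psi>: "\<psi> \<in> colourings (fst H)" "disc H = disc_colouring H \<psi>"
    by auto
  have "\<bar>\<Sum>v\<in>e. \<psi> v\<bar> \<le> disc H" if "e \<in># snd H" for e
    unfolding \<psi>(2) disc_colouring_def using that by (intro Max_ge) auto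
  then show ?thesis
    using \<psi>(1) assms(2) by (meson of_int_le_iff order_le_less_trans)
qed

text \<open>
  A colouring that witnesses \<open>disc H < t\<close> keeps every edge below \<open>t\<close>. For a fixed colouring
  this has probability at most \<open>r ^ m\<close> by independence of the edges.
\<close>

lemma prob_disc_less_le:
  assumes "\<And>\<psi>. \<psi> \<in> colourings {1..n} \<Longrightarrow>
    measure_pmf.prob (random_subset {1..n} p) {e. real_of_int \<bar>\<Sum>v\<in>e. \<psi> v\<bar> < t} \<le> r"
  shows "measure_pmf.prob (edge_independent n m p) {H. real_of_int (disc H) < t} \<le> 2 ^ n * r ^ m"
proof -
  let ?M = "edge_independent n m p"
  let ?E = "\<lambda>\<psi>. {H. \<forall>e\<in>#snd H. e \<in> {e. real_of_int \<bar>\<Sum>v\<in>e. \<psi> v\<bar> < t}}"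
  have "measure_pmf.prob ?M {H. real_of_int (disc H) < t}
      \<le> measure_pmf.prob ?M (\<Union>\<psi>\<in>colourings {1..n}. ?E \<psi> :: nat hypergraph set)"
  proof (rule measure_pmf.finite_measure_mono_AE)
    show "AE H in ?M. H \<in> {H. real_of_int (disc H) < t} \<longrightarrow> H \<in> (\<Union>\<psi>\<in>colourings {1..n}. ?E \<psi>)"
      unfolding AE_measure_pmf_iff
    proof (intro ballI impI)
      fix H assume "H \<in> set_pmf ?M" "H \<in> {H. real_of_int (disc H) < t}"
      then show "H \<in> (\<Union>\<psi>\<in>colourings {1..n}. ?E \<psi>)"
        using ex_colouring_if_disc_less[of H t] edge_independent_hypergraph(2)[of H n m p] by simp
    qed
  qed simp
  also have "\<dots> \<le> (\<Sum>\<psi>\<in>colourings {1..n}. measure_pmf.prob ?M (?E \<psi>))"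
    by (intro measure_pmf.finite_measure_subadditive_finite finite_colourings) auto
  also have "\<dots> \<le> (\<Sum>\<psi>\<in>colourings {1..n}. r ^ m)"
    unfolding prob_all_edges by (intro sum_mono power_mono assms) auto
  also have "\<dots> = 2 ^ n * r ^ m"
    by (simp add: card_colourings)
  finally show ?thesis .
qed

section \<open>Anti-concentration by Fourier inversion\<close>

text \<open>
  The Taylor expansion gives \<open>1 - cos t \<ge> t\<^sup>2 (1/2 - t\<^sup>2/24)\<close>, and \<open>t\<^sup>2 \<le> \<pi>\<^sup>2 < 10\<close>.
\<close>

lemma one_minus_cos_ge:
  assumes "\<bar>t\<bar> \<le> pi"
  shows "t\<^sup>2 / 12 \<le> 1 - cos (t :: real)"
proof -
  obtain s where s: "cos t = (\<Sum>i<4. cos_coeff i * t ^ i) + (cos (s + 1/2 * real (4::nat) * pi) / fact 4) * t ^ 4"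
    using Maclaurin_cos_expansion[of t 4] by blast
  have "(cos (s + 1/2 * real (4::nat) * pi) / fact 4) * t ^ 4 \<le> (1 / fact 4) * t ^ 4"
    by (intro mult_right_mono divide_right_mono) auto
  moreover have "{..<4::nat} = {0, 1, 2, 3}" by auto
  then have "(\<Sum>i<4. cos_coeff i * t ^ i) = 1 - t\<^sup>2 / 2"
    by (simp add: cos_coeff_def)
  ultimately have "cos t \<le> 1 - t\<^sup>2 / 2 + t ^ 4 / 24"
    using s by (simp add: fact_numeral)
  moreover have "t\<^sup>2 \<le> 10"
  proof -
    have "t\<^sup>2 \<le> pi\<^sup>2"
      using assms by (metis abs_le_square_iff abs_of_pos pi_gt_zero)
    also have "\<dots> \<le> 3.15\<^sup>2"
      using pi_approx(2) by (intro power_mono) auto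
    also have "\<dots> \<le> (10::real)" by (simp add: power2_eq_square)
    finally show ?thesis .
  qed
  then have "t\<^sup>2 * t\<^sup>2 \<le> 10 * t\<^sup>2"
    by (intro mult_right_mono) auto
  ultimately show ?thesis
    by (simp add: power4_eq_xxxx power2_eq_square mult.assoc)
qed

lemma has_integral_cos_int_multiple:
  "((\<lambda>t. cos (t * real_of_int j)) has_integral (if j = 0 then 2 * pi else 0)) {-pi..pi}"
proof (cases "j = 0")
  case True
  then show ?thesis
    using has_integral_const_real[of "1::real" "-pi" pi] by simp
next
  case False
  have "((\<lambda>t. cos (t * real_of_int j)) has_integral
      (sin (pi * real_of_int j) / j - sin (- pi * real_of_int j) / j)) {-pi..pi}"
    using False
    by (intro fundamental_theorem_of_calculus)
      (auto intro!: derivative_eq_intros simp flip: has_real_derivative_iff_has_vector_derivative)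
  moreover have "sin (pi * real_of_int j) = 0"
    by (metis mult.commute sin_npi_int)
  ultimately show ?thesis using False by simp
qed

lemma has_integral_inverse_quadratic:
  fixes b c :: real
  assumes "b > 0" "c \<ge> 0"
  shows "((\<lambda>t. 1 / (1 + b * t\<^sup>2)) has_integral 2 * arctan (sqrt b * c) / sqrt b) {-c..c}"
proof -
  have "((\<lambda>t. 1 / (1 + b * t\<^sup>2)) has_integral
      arctan (sqrt b * c) / sqrt b - arctan (sqrt b * - c) / sqrt b) {-c..c}"
  proof (rule fundamental_theorem_of_calculus)
    fix t :: real
    have "((\<lambda>t. arctan (sqrt b * t) / sqrt b) has_real_derivative
        (inverse (1 + (sqrt b * t)\<^sup>2) * sqrt b / sqrt b)) (at t within {-c..c})"
      using assms(1) by (auto intro!: derivative_eq_intros simp: divide_simps simp del: real_sqrt_eq_zero_cancel_iff)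
    then have "((\<lambda>t. arctan (sqrt b * t) / sqrt b) has_real_derivative
        (1 / (1 + b * t\<^sup>2))) (at t within {-c..c})"
      by (rule DERIV_cong) (use assms(1) in \<open>simp add: power_mult_distrib inverse_eq_divide\<close>)
    then show "((\<lambda>t. arctan (sqrt b * t) / sqrt b) has_vector_derivative
        (1 / (1 + b * t\<^sup>2))) (at t within {-c..c})"
      by (simp add: has_real_derivative_iff_has_vector_derivative)
  qed (use assms in auto)
  then show ?thesis by (simp add: arctan_minus)
qed

text \<open>
  By orthogonality of the cosines, \<open>2\<pi> P(Z = k)\<close> is the integral of \<open>E cos (t (Z - k))\<close> over
  \<open>[-\<pi>, \<pi>]\<close>, and the integrand is at most the modulus of the characteristic function of \<open>Z\<close>.
  The Gaussian-type bound on this modulus is relaxed to \<open>1 / (1 + (a/12) t\<^sup>2)\<close>, which has an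
  elementary antiderivative and costs only a constant factor.
\<close>

lemma prob_eq_le_if_char_decays:
  fixes Z :: "'a \<Rightarrow> int"
  assumes fin: "finite (set_pmf M)" and a: "a > 0"
    and char: "\<And>t. \<bar>t\<bar> \<le> pi \<Longrightarrow>
      norm (measure_pmf.expectation M (\<lambda>e. cis (t * Z e))) \<le> exp (- (a * (1 - cos t)))"
  shows "measure_pmf.prob M {e. Z e = k} \<le> 2 / sqrt a"
proof -
  let ?S = "set_pmf M"
  let ?F = "\<lambda>t. \<Sum>e\<in>?S. pmf M e * cos (t * real_of_int (Z e - k))"
  have "(?F has_integral (\<Sum>e\<in>?S. pmf M e * (if Z e - k = 0 then 2 * pi else 0))) {-pi..pi}"
    by (intro has_integral_sum[OF fin] has_integral_mult_right has_integral_cos_int_multiple)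
  also have "(\<Sum>e\<in>?S. pmf M e * (if Z e - k = 0 then 2 * pi else 0))
      = 2 * pi * (\<Sum>e\<in>?S \<inter> {e. Z e = k}. pmf M e)"
    using fin by (simp add: sum.If_cases sum_distrib_left if_distrib mult_ac cong: if_cong)
  also have "(\<Sum>e\<in>?S \<inter> {e. Z e = k}. pmf M e) = measure_pmf.prob M {e. Z e = k}"
    using fin by (metis finite_Int inf_commute measure_Int_set_pmf measure_measure_pmf_finite)
  finally have F: "(?F has_integral 2 * pi * measure_pmf.prob M {e. Z e = k}) {-pi..pi}" .
  have F_le: "?F t \<le> 1 / (1 + (a / 12) * t\<^sup>2)" if t: "t \<in> {-pi..pi}" for t
  proof -
    let ?E = "measure_pmf.expectation M (\<lambda>e. cis (t * Z e))"
    have "?E = (\<Sum>e\<in>?S. pmf M e *\<^sub>R cis (t * Z e))"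
      using fin by (intro integral_measure_pmf) auto
    then have "?F t = Re (cis (- t * k) * ?E)"
      by (simp add: sum_distrib_left Re_sum cos_diff algebra_simps)
    also have "\<dots> \<le> norm (cis (- t * k) * ?E)" by (rule complex_Re_le_cmod)
    also have "\<dots> \<le> exp (- (a * (1 - cos t)))"
      using char[of t] t by (auto simp: norm_mult)
    also have "\<dots> \<le> exp (- (a / 12 * t\<^sup>2))"
      using mult_left_mono[OF one_minus_cos_ge[of t], of a] t a by (simp add: abs_le_iff)
    also have "\<dots> \<le> 1 / (1 + a / 12 * t\<^sup>2)"
      using a exp_ge_add_one_self[of "a / 12 * t\<^sup>2"]
      by (simp add: exp_minus field_simps add_pos_nonneg)
    finally show ?thesis .
  qed
  have "2 * pi * measure_pmf.prob M {e. Z e = k} \<le> 2 * arctan (sqrt (a / 12) * pi) / sqrt (a / 12)"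
    using a by (intro has_integral_le[OF F has_integral_inverse_quadratic F_le]) auto
  also have "\<dots> \<le> 2 * (pi / 2) / sqrt (a / 12)"
    using a arctan_ubound[of "sqrt (a / 12) * pi"] by (intro divide_right_mono mult_left_mono) auto
  also have "\<dots> = pi * (sqrt 12 / sqrt a)"
    by (simp add: real_sqrt_divide)
  also have "\<dots> \<le> pi * (4 / sqrt a)"
    using a by (intro mult_left_mono divide_right_mono real_le_lsqrt) auto
  finally have "pi * (2 * measure_pmf.prob M {e. Z e = k}) \<le> pi * (4 / sqrt a)" by simp
  then show ?thesis by (subst (asm) mult_le_cancel_left_pos) auto
qed

text \<open>
  Each vertex contributes a factor \<open>p cis (\<plusminus>t) + (1 - p)\<close>. Its squared modulus
  \<open>1 - 2 p (1 - p) (1 - cos t)\<close> does not depend on the sign, so the bound is uniform in the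
  colouring.
\<close>

lemma norm_char_random_subset_le:
  fixes \<psi> :: "'a \<Rightarrow> int" and p t :: real
  assumes "finite V" "0 \<le> p" "p \<le> 1" "\<And>v. v \<in> V \<Longrightarrow> \<psi> v \<in> {-1, 1}"
  shows "norm (measure_pmf.expectation (random_subset V p) (\<lambda>e. cis (t * (\<Sum>v\<in>e. \<psi> v))))
       \<le> exp (- (p * (1 - p) * card V * (1 - cos t)))"
proof -
  have "(\<Prod>v\<in>e. cis (t * \<psi> v)) = cis (t * (\<Sum>v\<in>e. \<psi> v))" for e
    by (induction e rule: infinite_finite_induct) (simp_all add: cis_mult algebra_simps)
  then have "norm (measure_pmf.expectation (random_subset V p) (\<lambda>e. cis (t * (\<Sum>v\<in>e. \<psi> v))))
      = (\<Prod>v\<in>V. norm (of_real p * cis (t * \<psi> v) + of_real (1 - p)))"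
    using expectation_prod_random_subset[OF assms(1-3), where g = "\<lambda>v. cis (t * \<psi> v)"]
    by (simp add: prod_norm)
  also have "\<dots> \<le> (\<Prod>v\<in>V. exp (- (p * (1 - p) * (1 - cos t))))"
  proof (intro prod_mono conjI norm_ge_zero)
    fix v assume "v \<in> V"
    let ?z = "of_real p * cis (t * \<psi> v) + of_real (1 - p)"
    have cs: "cos (t * \<psi> v) = cos t" "(sin (t * \<psi> v))\<^sup>2 = (sin t)\<^sup>2"
      using assms(4)[OF \<open>v \<in> V\<close>] by auto
    have "(norm ?z)\<^sup>2 = (p * cos t + (1 - p))\<^sup>2 + p\<^sup>2 * (sin t)\<^sup>2"
      by (simp add: cmod_power2 cs power_mult_distrib)
    also have "\<dots> = 1 - 2 * p * (1 - p) * (1 - cos t)"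
      unfolding sin_squared_eq by algebra
    also have "\<dots> \<le> exp (- (2 * p * (1 - p) * (1 - cos t)))"
      using exp_ge_add_one_self[of "- (2 * p * (1 - p) * (1 - cos t))"] by simp
    also have "\<dots> = (exp (- (p * (1 - p) * (1 - cos t))))\<^sup>2"
      by (subst exp_double[symmetric]) (simp add: algebra_simps)
    finally show "norm ?z \<le> exp (- (p * (1 - p) * (1 - cos t)))"
      by (rule power2_le_imp_le) simp
  qed
  also have "\<dots> = exp (- (p * (1 - p) * card V * (1 - cos t)))"
    by (simp flip: exp_of_nat_mult add: mult_ac)
  finally show ?thesis .
qed

lemma prob_sum_eq_le:
  fixes \<psi> :: "'a \<Rightarrow> int" and p :: real
  assumes "finite V" "V \<noteq> {}" "0 < p" "p < 1" "\<And>v. v \<in> V \<Longrightarrow> \<psi> v \<in> {-1, 1}"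
  shows "measure_pmf.prob (random_subset V p) {e. (\<Sum>v\<in>e. \<psi> v) = k}
       \<le> 2 / sqrt (p * (1 - p) * card V)"
  using assms(1-4) norm_char_random_subset_le[OF assms(1) _ _ assms(5)]
  by (intro prob_eq_le_if_char_decays) (simp_all add: card_gt_0_iff)

text \<open>
  At most \<open>2 t + 1 \<le> 3 t\<close> integers lie in the window, and each of them is hit with probability at
  most \<open>2 / sqrt (p (1 - p) \<bar>V\<bar>)\<close>.
\<close>

lemma prob_sum_small_le:
  fixes \<psi> :: "'a \<Rightarrow> int" and p t :: real
  assumes "finite V" "V \<noteq> {}" "0 < p" "p < 1" "\<And>v. v \<in> V \<Longrightarrow> \<psi> v \<in> {-1, 1}" "t \<ge> 1"
  shows "measure_pmf.prob (random_subset V p) {e. real_of_int \<bar>\<Sum>v\<in>e. \<psi> v\<bar> < t}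
       \<le> 6 * t / sqrt (p * (1 - p) * card V)"
proof -
  let ?M = "random_subset V p" and ?K = "{-\<lfloor>t\<rfloor>..\<lfloor>t\<rfloor>}"
  have "measure_pmf.prob ?M {e. real_of_int \<bar>\<Sum>v\<in>e. \<psi> v\<bar> < t}
      \<le> measure_pmf.prob ?M (\<Union>k\<in>?K. {e. (\<Sum>v\<in>e. \<psi> v) = k})"
  proof (intro measure_pmf.finite_measure_mono subsetI)
    fix e assume "e \<in> {e. real_of_int \<bar>\<Sum>v\<in>e. \<psi> v\<bar> < t}"
    then have "\<bar>\<Sum>v\<in>e. \<psi> v\<bar> \<le> \<lfloor>t\<rfloor>" by (simp only: mem_Collect_eq le_floor_iff less_imp_le)
    then show "e \<in> (\<Union>k\<in>?K. {e. (\<Sum>v\<in>e. \<psi> v) = k})" by (simp add: abs_le_iff)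
  qed simp
  also have "\<dots> \<le> (\<Sum>k\<in>?K. measure_pmf.prob ?M {e. (\<Sum>v\<in>e. \<psi> v) = k})"
    by (intro measure_pmf.finite_measure_subadditive_finite) auto
  also have "\<dots> \<le> (\<Sum>k\<in>?K. 2 / sqrt (p * (1 - p) * card V))"
    by (intro sum_mono prob_sum_eq_le assms)
  also have "\<dots> = (2 * real_of_int \<lfloor>t\<rfloor> + 1) * (2 / sqrt (p * (1 - p) * card V))"
    using assms(6) by simp
  also have "\<dots> \<le> (3 * t) * (2 / sqrt (p * (1 - p) * card V))"
    using assms by (intro mult_right_mono) (linarith, auto)
  finally show ?thesis by simp
qed

text \<open>
  The probability of an even size is \<open>(1 + E (-1) ^ \<bar>e\<bar>) / 2\<close>, and \<open>(-1) ^ k = cis (\<pi> k)\<close>: this is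
  the characteristic function of the colouring that is constantly \<open>1\<close>, at the point \<open>\<pi>\<close>.
\<close>

lemma prob_even_card_le:
  fixes p :: real
  assumes "finite V" "0 \<le> p" "p \<le> 1"
  shows "measure_pmf.prob (random_subset V p) {e. even (card e)}
       \<le> (1 + exp (- (2 * (p * (1 - p) * card V)))) / 2"
proof -
  let ?M = "random_subset V p"
  have "(1 + Re (cis (pi * card e))) / 2 = indicat_real {e. even (card e)} e" for e :: "'a set"
    by (simp add: cos_npi2 uminus_power_if)
  then have "measure_pmf.prob ?M {e. even (card e)}
      = measure_pmf.expectation ?M (\<lambda>e. (1 + Re (cis (pi * card e))) / 2)"
    by simp
  also have "\<dots> = (1 + measure_pmf.expectation ?M (\<lambda>e. Re (cis (pi * card e)))) / 2"
    using assms(1) by (simp add: integrable_random_subset)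
  also have "measure_pmf.expectation ?M (\<lambda>e. Re (cis (pi * card e)))
      = Re (measure_pmf.expectation ?M (\<lambda>e. cis (pi * card e)))"
    by (intro integral_Re integrable_random_subset assms(1))
  also have "Re (measure_pmf.expectation ?M (\<lambda>e. cis (pi * card e)))
      \<le> norm (measure_pmf.expectation ?M (\<lambda>e. cis (pi * card e)))"
    by (rule complex_Re_le_cmod)
  also have "\<dots> \<le> exp (- (p * (1 - p) * card V * (1 - cos pi)))"
    using norm_char_random_subset_le[OF assms, of "\<lambda>_. 1" pi] by simp
  finally show ?thesis by (simp add: mult_ac)
qed

section \<open>Lower bounds for tails by exponential moments\<close>

lemma exp_quadratic_bounds:
  fixes y :: real
  assumes "\<bar>y\<bar> \<le> 1/2"
  shows "1 + y + y\<^sup>2 / 4 \<le> exp y" "exp y \<le> 1 + y + y\<^sup>2"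
proof -
  obtain t where t: "\<bar>t\<bar> \<le> \<bar>y\<bar>" "exp y = (\<Sum>i<2. y ^ i / fact i) + exp t / fact 2 * y ^ 2"
    using Maclaurin_exp_le[of y 2] by blast
  have y: "exp y = 1 + y + exp t / 2 * y\<^sup>2"
    using t(2) by (simp add: numeral_2_eq_2)
  have "1/2 \<le> exp t"
    using exp_ge_add_one_self[of t] t(1) assms by linarith
  then have "1/4 * y\<^sup>2 \<le> exp t / 2 * y\<^sup>2"
    by (intro mult_right_mono) auto
  then show "1 + y + y\<^sup>2 / 4 \<le> exp y" using y by simp
  have "exp t \<le> exp (1/2)"
    using t(1) assms by simp
  also have "\<dots> \<le> 2" using exp_bound_half[of "1/2::real"] by simp
  finally have "exp t / 2 * y\<^sup>2 \<le> 1 * y\<^sup>2"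
    by (intro mult_right_mono) auto
  then show "exp y \<le> 1 + y + y\<^sup>2" using y by simp
qed

text \<open>
  The moment generating function of a centred Bernoulli variable, which takes the value \<open>1 - p\<close>
  with probability \<open>p\<close> and \<open>- p\<close> otherwise. The linear terms of the quadratic bounds on \<open>exp\<close>
  cancel, and the quadratic terms add up to the variance \<open>p (1 - p)\<close>.
\<close>

lemma centred_bernoulli_mgf_bounds:
  fixes p x :: real
  assumes "0 \<le> p" "p \<le> 1" "\<bar>x\<bar> \<le> 1/2"
  shows "1 + p * (1 - p) * x\<^sup>2 / 4 \<le> p * exp (x * (1 - p)) + (1 - p) * exp (- (x * p))" (is ?L)
    and "p * exp (x * (1 - p)) + (1 - p) * exp (- (x * p)) \<le> 1 + p * (1 - p) * x\<^sup>2" (is ?U)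
proof -
  have b: "\<bar>x * (1 - p)\<bar> \<le> 1/2" "\<bar>- (x * p)\<bar> \<le> 1/2"
    using assms mult_mono[of "\<bar>x\<bar>" "1/2" "1 - p" 1] mult_mono[of "\<bar>x\<bar>" "1/2" p 1]
    by (auto simp: abs_mult)
  have "p * (1 + x * (1 - p) + (x * (1 - p))\<^sup>2 / 4) + (1 - p) * (1 + - (x * p) + (- (x * p))\<^sup>2 / 4)
      \<le> p * exp (x * (1 - p)) + (1 - p) * exp (- (x * p))"
    using assms by (intro add_mono mult_left_mono exp_quadratic_bounds b) auto
  moreover have "p * (1 + x * (1 - p) + (x * (1 - p))\<^sup>2 / 4) + (1 - p) * (1 + - (x * p) + (- (x * p))\<^sup>2 / 4)
      = 1 + p * (1 - p) * x\<^sup>2 / 4"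
    by (simp add: power2_eq_square field_simps)
  ultimately show ?L by simp
  have "p * exp (x * (1 - p)) + (1 - p) * exp (- (x * p))
      \<le> p * (1 + x * (1 - p) + (x * (1 - p))\<^sup>2) + (1 - p) * (1 + - (x * p) + (- (x * p))\<^sup>2)"
    using assms by (intro add_mono mult_left_mono exp_quadratic_bounds b) auto
  also have "\<dots> = 1 + p * (1 - p) * x\<^sup>2"
    by (simp add: power2_eq_square algebra_simps)
  finally show ?U .
qed

lemma expectation_exp_centred_sum:
  fixes \<psi> :: "'a \<Rightarrow> int" and p x :: real
  assumes "finite V" "0 \<le> p" "p \<le> 1"
  shows "measure_pmf.expectation (random_subset V p)
           (\<lambda>e. exp (x * ((\<Sum>v\<in>e. \<psi> v) - p * (\<Sum>v\<in>V. \<psi> v))))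
       = (\<Prod>v\<in>V. p * exp (x * \<psi> v * (1 - p)) + (1 - p) * exp (- (x * \<psi> v * p)))"
proof -
  have exp_sum': "exp (y * (\<Sum>v\<in>e. real_of_int (\<psi> v))) = (\<Prod>v\<in>e. exp (y * \<psi> v))" for e y
    by (induction e rule: infinite_finite_induct) (simp_all add: exp_add algebra_simps)
  have "exp (x * ((\<Sum>v\<in>e. \<psi> v) - p * (\<Sum>v\<in>V. \<psi> v)))
      = exp ((- x * p) * (\<Sum>v\<in>V. \<psi> v)) * (\<Prod>v\<in>e. exp (x * \<psi> v))" for e
    by (simp flip: exp_sum' exp_add add: algebra_simps)
  then have "measure_pmf.expectation (random_subset V p)
        (\<lambda>e. exp (x * ((\<Sum>v\<in>e. \<psi> v) - p * (\<Sum>v\<in>V. \<psi> v))))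
      = exp ((- x * p) * (\<Sum>v\<in>V. \<psi> v)) * (\<Prod>v\<in>V. p * exp (x * \<psi> v) + (1 - p))"
    using expectation_prod_random_subset[OF assms, where g = "\<lambda>v. exp (x * \<psi> v)"] by simp
  also have "\<dots> = (\<Prod>v\<in>V. exp ((- x * p) * \<psi> v) * (p * exp (x * \<psi> v) + (1 - p)))"
    using exp_sum'[of "- x * p" V] by (simp add: prod.distrib)
  also have "\<dots> = (\<Prod>v\<in>V. p * exp (x * \<psi> v * (1 - p)) + (1 - p) * exp (- (x * \<psi> v * p)))"
    by (intro prod.cong refl) (simp add: algebra_simps flip: exp_add)
  finally show ?thesis .
qed

text \<open>
  If \<open>\<mu> = E W\<close> and \<open>A\<close> is the event \<open>W \<ge> \<mu>/2\<close>, then \<open>W \<le> \<mu>/2 + (s W\<^sup>2 + 1\<^sub>A/s)/2\<close> pointwise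
  for every \<open>s > 0\<close>: outside \<open>A\<close> trivially, on \<open>A\<close> by the inequality of arithmetic and geometric
  means. Taking expectations with \<open>s = \<mu>/(2 B)\<close> gives the claim; using this inequality for all
  \<open>s\<close> takes the place of the Cauchy-Schwarz inequality.
\<close>

lemma paley_zygmund_half:
  fixes W :: "'a \<Rightarrow> real"
  assumes fin: "finite (set_pmf M)" and pos: "measure_pmf.expectation M W > 0"
    and snd: "measure_pmf.expectation M (\<lambda>x. (W x)\<^sup>2) \<le> B"
  shows "(measure_pmf.expectation M W)\<^sup>2 / (4 * B)
       \<le> measure_pmf.prob M {x. W x \<ge> measure_pmf.expectation M W / 2}"
proof -
  define \<mu> where "\<mu> = measure_pmf.expectation M W"
  define A where "A = {x. W x \<ge> \<mu> / 2}"
  have \<mu>: "\<mu> > 0" using pos by (simp add: \<mu>_def)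
  have int: "integrable (measure_pmf M) f" for f :: "'a \<Rightarrow> real"
    using fin by (rule integrable_measure_pmf_finite)
  have lin: "\<mu> \<le> \<mu> / 2 + (s * B + measure_pmf.prob M A / s) / 2" if s: "s > 0" for s
  proof -
    have "W x \<le> \<mu> / 2 + (s * (W x)\<^sup>2 + indicat_real A x / s) / 2" for x
    proof (cases "x \<in> A")
      case True
      have "0 \<le> (s * W x - 1)\<^sup>2 / s" using s by simp
      also have "\<dots> = s * (W x)\<^sup>2 + 1 / s - 2 * W x"
        using s by (simp add: power2_eq_square field_simps)
      finally have "W x \<le> (s * (W x)\<^sup>2 + 1 / s) / 2" by simp
      then have "W x \<le> \<mu> / 2 + (s * (W x)\<^sup>2 + 1 / s) / 2"
        using \<mu> by (intro add_increasing) auto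
      then show ?thesis using True by simp
    next
      case False
      moreover have "0 \<le> s * (W x)\<^sup>2" using s by simp
      ultimately show ?thesis by (simp add: A_def)
    qed
    then have "\<mu> \<le> measure_pmf.expectation M (\<lambda>x. \<mu> / 2 + (s * (W x)\<^sup>2 + indicat_real A x / s) / 2)"
      unfolding \<mu>_def by (intro integral_mono int)
    also have "\<dots> = \<mu> / 2 + (s * measure_pmf.expectation M (\<lambda>x. (W x)\<^sup>2) + measure_pmf.prob M A / s) / 2"
      using int by simp
    also have "\<dots> \<le> \<mu> / 2 + (s * B + measure_pmf.prob M A / s) / 2"
      using snd s by simp
    finally show ?thesis .
  qed
  (* For B <= 0 the choice s = 2/mu would already give mu <= 3/4 mu. *)
  have B: "B > 0"
  proof (rule ccontr)
    assume "\<not> B > 0"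
    then have "(2 / \<mu>) * B \<le> 0" using \<mu> by (intro mult_nonneg_nonpos) auto
    moreover have "measure_pmf.prob M A / (2 / \<mu>) \<le> \<mu> / 2"
      using \<mu> mult_right_mono[OF measure_pmf.prob_le_1[of M A], of \<mu>] by simp
    moreover have "0 < 2 / \<mu>" using \<mu> by simp
    note lin[OF this]
    ultimately have "\<mu> \<le> \<mu> / 2 + (0 + \<mu> / 2) / 2"
      by (elim order_trans) (intro add_left_mono divide_right_mono add_mono, auto)
    then show False using \<mu> by simp
  qed
  have "\<mu> \<le> \<mu> / 2 + (\<mu> / 2 + measure_pmf.prob M A * (2 * B / \<mu>)) / 2"
    using lin[of "\<mu> / (2 * B)"] \<mu> B by simp
  then have "\<mu>\<^sup>2 \<le> 4 * B * measure_pmf.prob M A"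
    using \<mu> by (simp add: field_simps power2_eq_square)
  then show ?thesis
    using B unfolding A_def \<mu>_def by (simp add: field_simps)
qed

text \<open>
  The Paley-Zygmund inequality for \<open>W = exp (x (\<psi>(e) - E \<psi>(e)))\<close>, where \<open>E \<psi>(e) = p \<psi>(V)\<close>. The
  factors of \<open>E W\<close> and of \<open>E W\<^sup>2\<close> are compared with exponentials one vertex at a time; the
  hypothesis \<open>x \<le> 1/4\<close> keeps the exponents, also those of \<open>W\<^sup>2\<close>, in the range of the quadratic
  bounds. A nonnegative mean of \<open>\<psi>(e)\<close> can only help it to be large.
\<close>

lemma prob_sum_large_ge_nonneg_mean:
  fixes \<psi> :: "'a \<Rightarrow> int" and p x :: real
  assumes fin: "finite V" and p: "0 \<le> p" "p \<le> 1" and \<psi>: "\<And>v. v \<in> V \<Longrightarrow> \<psi> v \<in> {-1, 1}"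
    and x: "0 < x" "x \<le> 1/4" and mean: "(\<Sum>v\<in>V. \<psi> v) \<ge> 0"
  defines "L \<equiv> x\<^sup>2 * (p * (1 - p) * card V)"
  shows "exp (- 4 * L) / 4 \<le>
    measure_pmf.prob (random_subset V p) {e. real_of_int (\<Sum>v\<in>e. \<psi> v) \<ge> (L / 8 - ln 2) / x}"
proof -
  let ?M = "random_subset V p"
  define W where "W = (\<lambda>e. exp (x * ((\<Sum>v\<in>e. \<psi> v) - p * (\<Sum>v\<in>V. \<psi> v))))"
  have sq: "(y * \<psi> v)\<^sup>2 = y\<^sup>2" "\<bar>y * \<psi> v\<bar> = \<bar>y\<bar>" if "v \<in> V" for v and y :: real
    using \<psi>[OF that] by auto
  have c: "0 \<le> p * (1 - p)" "p * (1 - p) \<le> 1"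
    using p by (auto intro: mult_le_one)
  have "exp (L / 8) = (\<Prod>v\<in>V. exp (p * (1 - p) * x\<^sup>2 / 8))"
    by (simp add: L_def mult_ac flip: exp_of_nat_mult)
  also have "\<dots> \<le> measure_pmf.expectation ?M W"
    unfolding W_def expectation_exp_centred_sum[OF fin p]
  proof (intro prod_mono conjI)
    fix v assume v: "v \<in> V"
    define y where "y = p * (1 - p) * x\<^sup>2 / 8"
    have "x\<^sup>2 \<le> 1" using x by (simp add: power_le_one)
    then have y: "0 \<le> y" "y \<le> 1"
      using c mult_mono[of "p * (1 - p)" 1 "x\<^sup>2" 1] by (auto simp: y_def)
    then have "exp y \<le> 1 + y + y\<^sup>2" by (intro exp_bound)
    also have "\<dots> \<le> 1 + 2 * y"
      using y mult_left_le[of y y] by (simp add: power2_eq_square)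
    also have "\<dots> = 1 + p * (1 - p) * (x * \<psi> v)\<^sup>2 / 4"
      by (simp add: y_def sq[OF v])
    also have "\<dots> \<le> p * exp (x * \<psi> v * (1 - p)) + (1 - p) * exp (- (x * \<psi> v * p))"
      using x by (intro centred_bernoulli_mgf_bounds p) (simp add: sq[OF v])
    finally show "exp (p * (1 - p) * x\<^sup>2 / 8)
        \<le> p * exp (x * \<psi> v * (1 - p)) + (1 - p) * exp (- (x * \<psi> v * p))"
      by (simp add: y_def)
  qed simp
  finally have \<mu>: "exp (L / 8) \<le> measure_pmf.expectation ?M W" .
  have "measure_pmf.expectation ?M (\<lambda>e. (W e)\<^sup>2)
      = measure_pmf.expectation ?M (\<lambda>e. exp (2 * x * ((\<Sum>v\<in>e. \<psi> v) - p * (\<Sum>v\<in>V. \<psi> v))))"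
    by (simp add: W_def mult.assoc flip: exp_double)
  also have "\<dots> \<le> (\<Prod>v\<in>V. exp (4 * (p * (1 - p) * x\<^sup>2)))"
    unfolding expectation_exp_centred_sum[OF fin p]
  proof (intro prod_mono conjI)
    fix v assume v: "v \<in> V"
    have "p * exp (2 * x * \<psi> v * (1 - p)) + (1 - p) * exp (- (2 * x * \<psi> v * p))
        \<le> 1 + p * (1 - p) * (2 * x * \<psi> v)\<^sup>2"
      using x by (intro centred_bernoulli_mgf_bounds p) (simp add: sq[OF v])
    also have "\<dots> = 1 + 4 * (p * (1 - p) * x\<^sup>2)"
      using sq(1)[OF v, of "2 * x"] by (simp add: power_mult_distrib)
    also have "\<dots> \<le> exp (4 * (p * (1 - p) * x\<^sup>2))" by (rule exp_ge_add_one_self)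
    finally show "p * exp (2 * x * \<psi> v * (1 - p)) + (1 - p) * exp (- (2 * x * \<psi> v * p))
        \<le> exp (4 * (p * (1 - p) * x\<^sup>2))" .
  qed (use p in auto)
  also have "\<dots> = exp (4 * L)"
    by (simp add: L_def mult_ac flip: exp_of_nat_mult)
  finally have snd: "measure_pmf.expectation ?M (\<lambda>e. (W e)\<^sup>2) \<le> exp (4 * L)" .
  have L: "L \<ge> 0" using c by (simp add: L_def)
  have "exp (- 4 * L) / 4 \<le> (exp (L / 8))\<^sup>2 / (4 * exp (4 * L))"
    using L by (simp add: exp_minus field_simps)
  also have "\<dots> \<le> (measure_pmf.expectation ?M W)\<^sup>2 / (4 * exp (4 * L))"
    using \<mu> by (intro divide_right_mono power_mono) auto
  also have "\<dots> \<le> measure_pmf.prob ?M {e. W e \<ge> measure_pmf.expectation ?M W / 2}"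
    using fin \<mu> less_le_trans[OF exp_gt_zero \<mu>] by (intro paley_zygmund_half snd) auto
  also have "\<dots> \<le> measure_pmf.prob ?M {e. real_of_int (\<Sum>v\<in>e. \<psi> v) \<ge> (L / 8 - ln 2) / x}"
  proof (intro measure_pmf.finite_measure_mono subsetI CollectI)
    fix e assume "e \<in> {e. W e \<ge> measure_pmf.expectation ?M W / 2}"
    then have "exp (L / 8) / 2 \<le> W e" using \<mu> by simp
    moreover have "exp (L / 8 - ln 2) = exp (L / 8) / 2" by (simp add: exp_diff)
    ultimately have "exp (L / 8 - ln 2) \<le> W e" by simp
    then have "L / 8 - ln 2 \<le> x * ((\<Sum>v\<in>e. \<psi> v) - p * (\<Sum>v\<in>V. \<psi> v))"
      by (simp add: W_def)
    also have "\<dots> \<le> x * real_of_int (\<Sum>v\<in>e. \<psi> v)"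
    proof -
      have "0 \<le> p * real_of_int (\<Sum>v\<in>V. \<psi> v)"
        using mean p(1) by (intro mult_nonneg_nonneg) (simp_all only: of_int_0_le_iff)
      then show ?thesis using x(1) by (intro mult_left_mono) auto
    qed
    finally show "(L / 8 - ln 2) / x \<le> real_of_int (\<Sum>v\<in>e. \<psi> v)"
      using x(1) by (simp add: pos_divide_le_eq mult.commute)
  qed simp
  finally show ?thesis .
qed

text \<open>
  A colouring with negative total is replaced by its negative, which does not change \<open>\<bar>\<psi>(e)\<bar>\<close>.
\<close>

lemma prob_sum_large_ge:
  fixes \<psi> :: "'a \<Rightarrow> int" and p x :: real
  assumes fin: "finite V" and p: "0 \<le> p" "p \<le> 1" and \<psi>: "\<And>v. v \<in> V \<Longrightarrow> \<psi> v \<in> {-1, 1}"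
    and x: "0 < x" "x \<le> 1/4"
  defines "L \<equiv> x\<^sup>2 * (p * (1 - p) * card V)"
  shows "exp (- 4 * L) / 4 \<le>
    measure_pmf.prob (random_subset V p) {e. real_of_int \<bar>\<Sum>v\<in>e. \<psi> v\<bar> \<ge> (L / 8 - ln 2) / x}"
proof -
  define \<sigma> :: int where "\<sigma> = (if (\<Sum>v\<in>V. \<psi> v) \<ge> 0 then 1 else -1)"
  have "exp (- 4 * L) / 4 \<le>
      measure_pmf.prob (random_subset V p) {e. real_of_int (\<Sum>v\<in>e. \<sigma> * \<psi> v) \<ge> (L / 8 - ln 2) / x}"
    unfolding L_def using \<psi> by (intro prob_sum_large_ge_nonneg_mean fin p x)
      (auto simp: \<sigma>_def sum_negf)
  also have "\<dots> \<le> measure_pmf.prob (random_subset V p) {e. real_of_int \<bar>\<Sum>v\<in>e. \<psi> v\<bar> \<ge> (L / 8 - ln 2) / x}"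
  proof (intro measure_pmf.finite_measure_mono subsetI CollectI)
    fix e assume "e \<in> {e. real_of_int (\<Sum>v\<in>e. \<sigma> * \<psi> v) \<ge> (L / 8 - ln 2) / x}"
    moreover have "(\<Sum>v\<in>e. \<sigma> * \<psi> v) \<le> \<bar>\<Sum>v\<in>e. \<psi> v\<bar>"
      by (auto simp: \<sigma>_def sum_negf abs_le_iff)
    then have "real_of_int (\<Sum>v\<in>e. \<sigma> * \<psi> v) \<le> real_of_int \<bar>\<Sum>v\<in>e. \<psi> v\<bar>"
      by (simp only: of_int_le_iff)
    ultimately show "(L / 8 - ln 2) / x \<le> real_of_int \<bar>\<Sum>v\<in>e. \<psi> v\<bar>" by (simp only: mem_Collect_eq)
  qed simp
  finally show ?thesis .
qed

section \<open>Discrepancy\<close>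

lemma even_sum_signs_iff:
  fixes \<psi> :: "'a \<Rightarrow> int"
  assumes "finite e" "\<And>v. v \<in> e \<Longrightarrow> \<psi> v \<in> {-1, 1}"
  shows "even (\<Sum>v\<in>e. \<psi> v) \<longleftrightarrow> even (card e)"
  using assms
proof (induction e rule: finite_induct)
  case (insert v e)
  moreover have "odd (\<psi> v)" using insert.prems[of v] by auto
  ultimately show ?case by simp
qed simp

lemma colouringsD: "\<psi> \<in> colourings V \<Longrightarrow> v \<in> V \<Longrightarrow> \<psi> v \<in> {-1, 1}"
  by (auto simp: colourings_def PiE_def Pi_def)

text \<open>
  Discrepancy below \<open>1\<close> forces \<open>\<psi>(e) = 0\<close> for some colouring and all edges, and \<open>\<psi>(e)\<close> has the parity
  of the size of \<open>e\<close>. This avoids the union bound, which is too expensive when \<open>n/m\<close> is large.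
\<close>

lemma prob_disc_less_1_le:
  "measure_pmf.prob (edge_independent n m p) {H. real_of_int (disc H) < 1}
     \<le> measure_pmf.prob (random_subset {1..n} p) {e. even (card e)} ^ m"
proof -
  have "measure_pmf.prob (edge_independent n m p) {H. real_of_int (disc H) < 1}
      \<le> measure_pmf.prob (edge_independent n m p) {H. \<forall>e\<in>#snd H. e \<in> {e. even (card e)}}"
  proof (rule measure_pmf.finite_measure_mono_AE)
    show "AE H in edge_independent n m p. H \<in> {H. real_of_int (disc H) < 1} \<longrightarrow>
        H \<in> {H. \<forall>e\<in>#snd H. e \<in> {e. even (card e)}}"
      unfolding AE_measure_pmf_iff
    proof (intro ballI impI CollectI)
      fix H e
      assume H: "H \<in> set_pmf (edge_independent n m p)" "H \<in> {H. real_of_int (disc H) < 1}"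
        and e: "e \<in># snd H"
      have sub: "e \<subseteq> {1..n}"
        using edge_independent_hypergraph(1,2)[OF H(1)] e by (auto simp: hypergraph_def)
      obtain \<psi> where \<psi>: "\<psi> \<in> colourings {1..n}" "real_of_int \<bar>\<Sum>v\<in>e. \<psi> v\<bar> < 1"
        using ex_colouring_if_disc_less[of H 1] H(2) e edge_independent_hypergraph(2)[OF H(1)] by auto
      then have "(\<Sum>v\<in>e. \<psi> v) = 0" by (simp only: of_int_less_1_iff zabs_less_one_iff)
      then have "even (\<Sum>v\<in>e. \<psi> v)" by simp
      then show "even (card e)"
        using even_sum_signs_iff[of e \<psi>] colouringsD[OF \<psi>(1)] sub finite_subset[OF sub] by blast
    qed
  qed simp
  then show ?thesis by (simp only: prob_all_edges)
qed

text \<open>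
  With the constant \<open>sqrt \<epsilon> / 12\<close> the probability \<open>6 t / sqrt (p (1 - p) n)\<close> that a single edge is
  nearly balanced becomes at most \<open>2 powr (- n/m) / 2\<close>; the surplus factor \<open>1/2\<close> per edge is what
  remains after paying for all the colourings. The second case, where the claimed bound is at most
  \<open>1\<close>, is a matter of parity. The hypothesis on \<open>ln 2\<close> makes \<open>exp (- 2 p (1 - p) n) \<le> 1/2\<close>.
\<close>

lemma prob_disc_less_few_edges:
  fixes p \<epsilon> :: real
  assumes n: "n \<ge> 1" and m: "m \<ge> 1" and p: "0 < p" "p \<le> 1 - \<epsilon>" and \<epsilon>: "\<epsilon> > 0"
    and large: "2 * (p * (1 - p) * real n) \<ge> ln 2"
  shows "measure_pmf.prob (edge_independent n m p)
      {H. real_of_int (disc H) < sqrt \<epsilon> / 12 * max (2 powr (- (real n / real m)) * sqrt (p * n)) 1}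
    \<le> (3 / 4) ^ m"
proof -
  define s where "s = 2 powr (- (real n / real m))"
  define t where "t = sqrt \<epsilon> / 12 * (s * sqrt (p * n))"
  have \<kappa>: "sqrt \<epsilon> / 12 \<le> 1" using p \<epsilon> by (simp add: real_le_lsqrt)
  show ?thesis
  proof (cases "t \<ge> 1")
    case True
    moreover have "t \<le> 1 * (s * sqrt (p * n))"
      unfolding t_def using \<kappa> p by (intro mult_right_mono) (auto simp: s_def)
    ultimately have "1 \<le> s * sqrt (p * n)" by simp
    then have max: "sqrt \<epsilon> / 12 * max (s * sqrt (p * n)) 1 = t" by (simp add: t_def max_def)
    have "6 * t / sqrt (p * (1 - p) * n) \<le> 6 * t / sqrt (\<epsilon> * (p * n))"
      using True p \<epsilon> n mult_right_mono[of \<epsilon> "1 - p" "p * n"]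
      by (intro divide_left_mono real_sqrt_le_mono mult_pos_pos) (auto simp: mult_ac)
    also have "\<dots> = s / 2"
      using p \<epsilon> n by (simp add: t_def real_sqrt_mult)
    finally have r: "6 * t / sqrt (p * (1 - p) * n) \<le> s / 2" .
    have "measure_pmf.prob (edge_independent n m p) {H. real_of_int (disc H) < t} \<le> 2 ^ n * (s / 2) ^ m"
    proof (rule prob_disc_less_le)
      fix \<psi> :: "nat \<Rightarrow> int" assume \<psi>: "\<psi> \<in> colourings {1..n}"
      have "measure_pmf.prob (random_subset {1..n} p) {e. real_of_int \<bar>\<Sum>v\<in>e. \<psi> v\<bar> < t}
          \<le> 6 * t / sqrt (p * (1 - p) * card {1..n})"
        using n p \<epsilon> True by (intro prob_sum_small_le colouringsD[OF \<psi>]) auto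
      then show "measure_pmf.prob (random_subset {1..n} p) {e. real_of_int \<bar>\<Sum>v\<in>e. \<psi> v\<bar> < t} \<le> s / 2"
        using r by simp
    qed
    also have "s ^ m = 1 / 2 ^ n"
      using m by (simp add: s_def powr_minus powr_realpow[symmetric] powr_powr field_simps)
    then have "2 ^ n * (s / 2) ^ m = (1 / 2) ^ m"
      by (simp add: power_divide)
    also have "\<dots> \<le> (3 / 4) ^ m" by (intro power_mono) auto
    finally show ?thesis unfolding s_def[symmetric] max .
  next
    case False
    then have "sqrt \<epsilon> / 12 * max (s * sqrt (p * n)) 1 \<le> 1"
      using \<kappa> by (simp add: t_def max_def)
    then have "measure_pmf.prob (edge_independent n m p)
          {H. real_of_int (disc H) < sqrt \<epsilon> / 12 * max (s * sqrt (p * n)) 1}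
        \<le> measure_pmf.prob (edge_independent n m p) {H. real_of_int (disc H) < 1}"
      by (intro measure_pmf.finite_measure_mono) auto
    also have "\<dots> \<le> measure_pmf.prob (random_subset {1..n} p) {e. even (card e)} ^ m"
      by (rule prob_disc_less_1_le)
    also have "\<dots> \<le> (3 / 4) ^ m"
    proof (intro power_mono measure_nonneg)
      have "exp (- (2 * (p * (1 - p) * n))) \<le> exp (- ln 2)"
        using large by simp
      also have "\<dots> = (1 / 2 :: real)" by (simp add: exp_minus)
      finally show "measure_pmf.prob (random_subset {1..n} p) {e. even (card e)} \<le> 3 / 4"
        using prob_even_card_le[of "{1..n}" p] p \<epsilon> by simp
    qed
    finally show ?thesis unfolding s_def .
  qed
qed

text \<open>
  The parameter \<open>x\<close> of the exponential moment is chosen so that \<open>x\<^sup>2 p (1 - p) n = (ln \<gamma>)/8\<close>. The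
  lower bound \<open>exp 128\<close> makes this number at least \<open>16\<close>, so that the loss \<open>ln 2\<close> in the tail bound
  is negligible; it also gives \<open>\<gamma> \<ge> 64\<close>, which the final comparison with \<open>2 ^ n\<close> uses. The upper
  bound on \<open>ln \<gamma>\<close> is equivalent to \<open>x \<le> 1/4\<close> up to replacing \<open>1 - p\<close> by \<open>\<epsilon>\<close>.
\<close>

lemma prob_disc_less_many_edges:
  fixes p \<epsilon> \<gamma> :: real
  assumes n: "n \<ge> 1" and p: "0 < p" "p \<le> 1 - \<epsilon>" and \<epsilon>: "\<epsilon> > 0"
    and \<gamma>: "exp 128 \<le> \<gamma>" "\<gamma> \<le> real m / real n" "ln \<gamma> \<le> \<epsilon> * (p * n) / 2"
  shows "measure_pmf.prob (edge_independent n m p)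
      {H. real_of_int (disc H) < sqrt (\<epsilon> / 8) / 16 * sqrt (p * n * ln \<gamma>)} \<le> exp (- real n)"
proof -
  define a where "a = p * (1 - p) * n"
  define L where "L = ln \<gamma> / 8"
  define x where "x = sqrt (L / a)"
  define t where "t = sqrt (\<epsilon> / 8) / 16 * sqrt (p * n * ln \<gamma>)"
  define r where "r = exp (- (ln \<gamma> / 2)) / 4"
  have \<gamma>_pos: "\<gamma> > 0" using \<gamma>(1) exp_gt_zero[of "128::real"] by linarith
  have a: "a > 0" using n p \<epsilon> by (simp add: a_def)
  have \<epsilon>a: "\<epsilon> * (p * n) \<le> a"
    using mult_right_mono[of \<epsilon> "1 - p" "p * n"] p by (simp add: a_def mult_ac)
  have L: "L \<ge> 16"
    using \<gamma>(1) \<gamma>_pos by (simp add: L_def ln_ge_iff)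
  have x: "x > 0" using a L by (simp add: x_def)
  have "L / a \<le> (1 / 4)\<^sup>2"
    using \<gamma>(3) \<epsilon>a a by (simp add: L_def power2_eq_square field_simps)
  then have x_le: "x \<le> 1 / 4"
    unfolding x_def by (intro real_le_lsqrt) auto
  have x2: "x\<^sup>2 * a = L"
    using a L by (simp add: x_def)
  have t_le: "t \<le> (L / 8 - ln 2) / x"
  proof -
    have "t = sqrt (\<epsilon> * (p * n) * L) / 16"
      by (simp add: t_def L_def flip: real_sqrt_mult)
    also have "\<dots> \<le> sqrt (a * L) / 16"
      using \<epsilon>a L by (intro divide_right_mono real_sqrt_le_mono mult_right_mono) auto
    also have "a * L = (x * a)\<^sup>2"
      by (simp add: power_mult_distrib power2_eq_square flip: x2)
    also have "sqrt ((x * a)\<^sup>2) = L / x"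
      using x a by (simp flip: x2 add: power2_eq_square)
    also have "L / x / 16 = L / 16 / x" by simp
    also have "\<dots> \<le> (L / 8 - ln 2) / x"
      using x L ln_2_less_1 by (intro divide_right_mono) auto
    finally show ?thesis .
  qed
  have r: "0 \<le> r" "r \<le> 1"
    using L unfolding r_def L_def by (auto intro: order_trans[of _ 1])
  have "measure_pmf.prob (edge_independent n m p) {H. real_of_int (disc H) < t} \<le> 2 ^ n * (1 - r) ^ m"
  proof (rule prob_disc_less_le)
    fix \<psi> :: "nat \<Rightarrow> int" assume \<psi>: "\<psi> \<in> colourings {1..n}"
    let ?M = "random_subset {1..n} p"
    have "r = exp (- 4 * (x\<^sup>2 * (p * (1 - p) * card {1..n}))) / 4"
      using x2 by (simp add: r_def L_def a_def)
    also have "\<dots> \<le> measure_pmf.prob ?M {e. real_of_int \<bar>\<Sum>v\<in>e. \<psi> v\<bar> \<ge>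
        (x\<^sup>2 * (p * (1 - p) * card {1..n}) / 8 - ln 2) / x}"
      using p \<epsilon> x x_le by (intro prob_sum_large_ge colouringsD[OF \<psi>]) auto
    also have "\<dots> \<le> measure_pmf.prob ?M (- {e. real_of_int \<bar>\<Sum>v\<in>e. \<psi> v\<bar> < t})"
      using t_le x2 by (intro measure_pmf.finite_measure_mono) (auto simp: a_def)
    also have "\<dots> = 1 - measure_pmf.prob ?M {e. real_of_int \<bar>\<Sum>v\<in>e. \<psi> v\<bar> < t}"
      using measure_pmf.prob_compl[of "{e. real_of_int \<bar>\<Sum>v\<in>e. \<psi> v\<bar> < t}" ?M]
      by (simp add: Compl_eq_Diff_UNIV)
    finally show "measure_pmf.prob ?M {e. real_of_int \<bar>\<Sum>v\<in>e. \<psi> v\<bar> < t} \<le> 1 - r" by simp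
  qed
  also have "\<dots> \<le> exp (ln 2 * n) * exp (- r) ^ m"
  proof (intro mult_mono power_mono)
    show "1 - r \<le> exp (- r)" using exp_ge_add_one_self[of "- r"] by simp
    show "2 ^ n \<le> exp (ln 2 * real n)" by (simp add: mult.commute exp_of_nat_mult)
  qed (use r in auto)
  also have "\<dots> = exp (ln 2 * n - r * m)"
    by (simp add: mult.commute[of r] exp_diff exp_minus power_inverse exp_of_nat_mult divide_inverse)
  also have "\<dots> \<le> exp (- real n)"
  proof -
    (* The exponent r m is at least 2 n, while the number of colourings costs only n ln 2. *)
    have "8 * sqrt \<gamma> \<le> \<gamma>"
    proof -
      have "8\<^sup>2 \<le> \<gamma>"
        using \<gamma>(1) exp_ge_add_one_self[of "128::real"] by simp
      then have "8 \<le> sqrt \<gamma>" by (rule real_le_rsqrt)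
      then have "8 * sqrt \<gamma> \<le> sqrt \<gamma> * sqrt \<gamma>" using \<gamma>_pos by (intro mult_right_mono) auto
      then show ?thesis using \<gamma>_pos by simp
    qed
    then have "8 * sqrt \<gamma> * n \<le> \<gamma> * n"
      by (intro mult_right_mono) auto
    also have "\<dots> \<le> m"
      using \<gamma>(2) n by (simp add: field_simps)
    finally have "8 * sqrt \<gamma> * n \<le> m" .
    moreover have "r = 1 / (4 * sqrt \<gamma>)"
      using \<gamma>_pos by (simp add: r_def exp_minus ln_sqrt[symmetric] inverse_eq_divide)
    ultimately have "2 * n \<le> r * m"
      using \<gamma>_pos by (simp add: pos_le_divide_eq mult_ac)
    moreover have "ln 2 * n \<le> 1 * real n"
      using ln_2_less_1 by (intro mult_right_mono) auto
    ultimately show ?thesis by simp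
  qed
  finally show ?thesis unfolding t_def .
qed

lemma prob_ge_tendsto_1:
  fixes M :: "nat \<Rightarrow> 'a pmf" and X :: "'a \<Rightarrow> real"
  assumes bound: "\<forall>\<^sub>F n in sequentially. measure_pmf.prob (M n) {H. X H < g n} \<le> b n"
    and b: "b \<longlonglongrightarrow> 0"
  shows "(\<lambda>n. measure_pmf.prob (M n) {H. X H \<ge> g n}) \<longlonglongrightarrow> 1"
proof (rule tendsto_sandwich)
  show "(\<lambda>n. 1 - b n) \<longlonglongrightarrow> 1" using tendsto_diff[OF tendsto_const b, of 1] by simp
  show "\<forall>\<^sub>F n in sequentially. 1 - b n \<le> measure_pmf.prob (M n) {H. X H \<ge> g n}"
    using bound
  proof eventually_elim
    case (elim n)
    have "measure_pmf.prob (M n) {H. X H \<ge> g n} = 1 - measure_pmf.prob (M n) {H. X H < g n}"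
      using measure_pmf.prob_compl[of "{H. X H < g n}" "M n"]
      by (simp add: Compl_eq_Diff_UNIV[symmetric] Collect_neg_eq[symmetric] not_less)
    then show ?case using elim by simp
  qed
qed auto

theorem theorem1p1:
  fixes m :: "nat \<Rightarrow> nat" and p :: "nat \<Rightarrow> real"
  assumes m_pos: "\<And>n. n \<ge> 1 \<Longrightarrow> m n \<ge> 1"
    and p_prob: "\<And>n. n \<ge> 1 \<Longrightarrow> 0 \<le> p n \<and> p n \<le> 1"
    and pn: "filterlim (\<lambda>n. p n * real n) at_top sequentially"
    and pm: "filterlim (\<lambda>n. p n * real (m n)) at_top sequentially"
    and p_away: "\<exists>\<epsilon>\<^sub>0>0. \<forall>\<^sub>F n in sequentially. p n \<le> 1 - \<epsilon>\<^sub>0"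
  shows
    "((\<lambda>n. real (m n)) \<in> O(\<lambda>n. real n) \<longrightarrow>
        (\<exists>\<kappa>>0. (\<lambda>n. measure_pmf.prob (edge_independent n (m n) (p n))
             {H. real_of_int (disc H) \<ge>
                   \<kappa> * max (2 powr (- (real n / real (m n))) * sqrt (p n * real n)) 1})
           \<longlonglongrightarrow> 1)) \<and>
     ((\<lambda>n. real n / real (m n)) \<longlonglongrightarrow> 0 \<longrightarrow>
        (\<exists>\<kappa>>0. (\<lambda>n. measure_pmf.prob (edge_independent n (m n) (p n))
             {H. real_of_int (disc H) \<ge>
                   \<kappa> * sqrt (p n * real n *
                              ln (min (real (m n) / real n) (p n * real n)))})
           \<longlonglongrightarrow> 1))"
proof -
  obtain \<epsilon> where \<epsilon>: "\<epsilon> > 0" and away: "\<forall>\<^sub>F n in sequentially. p n \<le> 1 - \<epsilon>"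
    using p_away by blast
  have n_ge: "\<forall>\<^sub>F n in sequentially. n \<ge> (1::nat)" by (rule eventually_ge_at_top)
  have pn_ge: "\<forall>\<^sub>F n in sequentially. p n * real n \<ge> c" for c
    using pn by (simp add: filterlim_at_top)
  show ?thesis
  proof (intro conjI impI)
    have "filterlim (\<lambda>n. real (m n)) at_top sequentially"
    proof (rule filterlim_at_top_mono[OF pm])
      show "\<forall>\<^sub>F n in sequentially. p n * real (m n) \<le> real (m n)"
        using n_ge by eventually_elim (use p_prob in \<open>auto intro: mult_left_le_one_le\<close>)
    qed
    then have "filterlim m at_top sequentially"
      by (simp add: filterlim_sequentially_iff_filterlim_real)
    then have lim: "(\<lambda>n. (3 / 4 :: real) ^ m n) \<longlonglongrightarrow> 0"
      by (intro filterlim_compose[OF LIMSEQ_realpow_zero]) auto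
    show "\<exists>\<kappa>>0. (\<lambda>n. measure_pmf.prob (edge_independent n (m n) (p n))
        {H. real_of_int (disc H) \<ge>
          \<kappa> * max (2 powr (- (real n / real (m n))) * sqrt (p n * real n)) 1}) \<longlonglongrightarrow> 1"
    proof (intro exI[of _ "sqrt \<epsilon> / 12"] conjI prob_ge_tendsto_1[OF _ lim])
      show "\<forall>\<^sub>F n in sequentially. measure_pmf.prob (edge_independent n (m n) (p n))
          {H. real_of_int (disc H) <
            sqrt \<epsilon> / 12 * max (2 powr (- (real n / real (m n))) * sqrt (p n * real n)) 1}
          \<le> (3 / 4) ^ m n"
        using n_ge away pn_ge[of "1 / \<epsilon>"]
      proof eventually_elim
        case (elim n)
        have p0: "p n > 0"
          using elim p_prob[of n] \<epsilon> by (cases "p n = 0") auto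
        have "\<epsilon> * (p n * n) \<le> (1 - p n) * (p n * n)"
          using elim p0 by (intro mult_right_mono) auto
        moreover have "1 \<le> \<epsilon> * (p n * n)"
          using elim(3) \<epsilon> by (simp add: field_simps)
        ultimately have "2 * (p n * (1 - p n) * n) \<ge> ln 2"
          using ln_2_less_1 unfolding mult.commute[of "p n"] mult.assoc by linarith
        then show ?case
          using elim m_pos p0 \<epsilon> by (intro prob_disc_less_few_edges) auto
      qed
    qed (use \<epsilon> in auto)
  next
    assume sparse: "(\<lambda>n. real n / real (m n)) \<longlonglongrightarrow> 0"
    have "filterlim (\<lambda>n. inverse (real n / real (m n))) at_top sequentially"
    proof (rule filterlim_inverse_at_top[OF sparse])
      show "\<forall>\<^sub>F n in sequentially. 0 < real n / real (m n)"
        using n_ge by eventually_elim (use m_pos in \<open>force intro: divide_pos_pos\<close>)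
    qed
    then have mn_ge: "\<forall>\<^sub>F n in sequentially. real (m n) / real n \<ge> c" for c
      by (simp add: filterlim_at_top)
    have "((\<lambda>y::real. ln y / y) \<longlongrightarrow> 0) at_top" by (rule ln_x_over_x_tendsto_0)
    then have "\<forall>\<^sub>F y::real in at_top. ln y / y < \<epsilon> / 2"
      using \<epsilon> by (intro order_tendstoD) auto
    then have "\<forall>\<^sub>F n in sequentially. ln (p n * n) / (p n * n) < \<epsilon> / 2"
      using pn by (rule eventually_compose_filterlim)
    (* This is where p n -> infinity makes the exponential parameter small. *)
    then have ln_le: "\<forall>\<^sub>F n in sequentially. ln (p n * n) \<le> \<epsilon> * (p n * n) / 2"
      using pn_ge[of 1] by eventually_elim (simp add: field_simps)
    have lim: "(\<lambda>n. exp (- real n)) \<longlonglongrightarrow> 0"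
      by (rule filterlim_compose[OF exp_at_bot])
        (simp add: filterlim_uminus_at_bot filterlim_real_sequentially)
    show "\<exists>\<kappa>>0. (\<lambda>n. measure_pmf.prob (edge_independent n (m n) (p n))
        {H. real_of_int (disc H) \<ge>
          \<kappa> * sqrt (p n * real n * ln (min (real (m n) / real n) (p n * real n)))}) \<longlonglongrightarrow> 1"
    proof (intro exI[of _ "sqrt (\<epsilon> / 8) / 16"] conjI prob_ge_tendsto_1[OF _ lim])
      show "\<forall>\<^sub>F n in sequentially. measure_pmf.prob (edge_independent n (m n) (p n))
          {H. real_of_int (disc H) < sqrt (\<epsilon> / 8) / 16 *
            sqrt (p n * real n * ln (min (real (m n) / real n) (p n * real n)))}
          \<le> exp (- real n)"
        using n_ge away pn_ge[of "exp 128"] mn_ge[of "exp 128"] ln_le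
      proof eventually_elim
        case (elim n)
        let ?\<gamma> = "min (real (m n) / real n) (p n * real n)"
        have \<gamma>: "exp 128 \<le> ?\<gamma>" using elim by simp
        have p0: "p n > 0"
          using elim p_prob[of n] exp_gt_zero[of "128::real"] by (cases "p n = 0") auto
        have "ln ?\<gamma> \<le> ln (p n * n)"
          using less_le_trans[OF exp_gt_zero \<gamma>] by (intro ln_mono) auto
        then show ?case
          using elim \<gamma> p0 \<epsilon> by (intro prob_disc_less_many_edges) auto
      qed
    qed (use \<epsilon> in auto)
  qed
qed

end
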